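(* Let $u<v$ be real numbers. Every uniformly continuous function $f\colon[u,v]_{\mathbb{Q}}\to\mathbb{R}$ has the integral $(\mathbb{Q})\int_u^v f$.
   Context: For reals $u\le v$, $[u,v]_{\mathbb{Q}}=\{a\in\mathbb{Q}\mid u\le a\le v\}$. $f$ is uniformly continuous if for every $k\in\mathbb{N}$ there is $l$ with $a,b\in[u,v]_{\mathbb{Q}}$, $|a-b|\le1/l\Rightarrow|f(a)-f(b)|\le1/k$. A tagged partition $P$ of $[u,v]_{\mathbb{Q}}$ consists of reals $u=u_0<u_1<\dots<u_n=v$ ($n\ge1$) and rationals $b_i\in[u_{i-1},u_i]_{\mathbb{Q}}$; its norm is $\Delta(P)=\max_i(u_i-u_{i-1})$ and $R(f,P)=\sum_{i=1}^n f(b_i)(u_i-u_{i-1})$. The integral $(\mathbb{Q})\int_u^v f$ exists (and equals $L$) if for every sequence $(P_n)$ of tagged partitions with $\Delta(P_n)\to0$ the limit $L=\lim_n R(f,P_n)$ exists (it is then independent of the sequence). *)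

theory Defs
  imports "HOL-Analysis.Analysis"
begin

text \<open>A function on the rational interval is modelled as a function \<open>real \<Rightarrow> real\<close> whose values
  outside \<open>rat_interval u v\<close> are never inspected.\<close>

definition rat_interval :: "real \<Rightarrow> real \<Rightarrow> real set" where
  "rat_interval u v = {a \<in> \<rat>. u \<le> a \<and> a \<le> v}"

lemma uniformly_continuous_on_rat_interval_iff:
  "uniformly_continuous_on (rat_interval u v) f \<longleftrightarrow>
    (\<forall>k::nat. k \<ge> 1 \<longrightarrow> (\<exists>l::nat. l \<ge> 1 \<and>
      (\<forall>a\<in>rat_interval u v. \<forall>b\<in>rat_interval u v.
        \<bar>a - b\<bar> \<le> 1 / real l \<longrightarrow> \<bar>f a - f b\<bar> \<le> 1 / real k)))"
  (is "?L \<longleftrightarrow> ?R") for f :: "real \<Rightarrow> real"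
proof
  assume L: ?L
  show ?R
  proof (intro allI impI)
    fix k :: nat assume "k \<ge> 1"
    then have "1 / real k > 0" by simp
    then obtain d where d: "d > 0" "\<And>a b. a \<in> rat_interval u v \<Longrightarrow> b \<in> rat_interval u v \<Longrightarrow>
        dist b a < d \<Longrightarrow> dist (f b) (f a) < 1 / real k"
      using L unfolding uniformly_continuous_on_def by metis
    obtain m where m: "1 / real (Suc m) < d"
      using nat_approx_posE[OF d(1)] by auto
    show "\<exists>l::nat. l \<ge> 1 \<and>
      (\<forall>a\<in>rat_interval u v. \<forall>b\<in>rat_interval u v.
        \<bar>a - b\<bar> \<le> 1 / real l \<longrightarrow> \<bar>f a - f b\<bar> \<le> 1 / real k)"
    proof (intro exI[of _ "Suc m"] conjI ballI impI)
      fix a b assume ab: "a \<in> rat_interval u v" "b \<in> rat_interval u v" "\<bar>a - b\<bar> \<le> 1 / real (Suc m)"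
      then have "dist a b < d" using m unfolding dist_real_def by linarith
      from d(2)[OF ab(2,1) this] show "\<bar>f a - f b\<bar> \<le> 1 / real k" by (simp add: dist_real_def)
    qed simp
  qed
next
  assume R: ?R
  show ?L
    unfolding uniformly_continuous_on_def
  proof (intro allI impI)
    fix e :: real assume "e > 0"
    then obtain m where m: "1 / real (Suc m) < e"
      using nat_approx_posE by blast
    obtain l :: nat where l: "l \<ge> 1" "\<And>a b. a \<in> rat_interval u v \<Longrightarrow> b \<in> rat_interval u v \<Longrightarrow>
        \<bar>a - b\<bar> \<le> 1 / real l \<Longrightarrow> \<bar>f a - f b\<bar> \<le> 1 / real (Suc m)"
      using R[rule_format, of "Suc m"] by auto
    have "\<forall>x\<in>rat_interval u v. \<forall>x'\<in>rat_interval u v.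
        dist x' x < 1 / real l \<longrightarrow> dist (f x') (f x) < e"
    proof (intro ballI impI)
      fix a b assume "a \<in> rat_interval u v" "b \<in> rat_interval u v" "dist b a < 1 / real l"
      then have "\<bar>f b - f a\<bar> \<le> 1 / real (Suc m)"
        by (intro l(2)) (auto simp: dist_real_def)
      then show "dist (f b) (f a) < e" using m unfolding dist_real_def by linarith
    qed
    then show "\<exists>d>0. \<forall>x\<in>rat_interval u v. \<forall>x'\<in>rat_interval u v.
        dist x' x < d \<longrightarrow> dist (f x') (f x) < e"
      using l(1) by (intro exI[of _ "1 / real l"]) auto
  qed
qed

text \<open>With \<open>n = num_parts P\<close>, only the nodes \<open>0, \<dots>, n\<close> and the tags \<open>1, \<dots>, n\<close> are relevant.\<close>

record tagged_part =
  num_parts :: nat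
  node :: "nat \<Rightarrow> real"
  tag :: "nat \<Rightarrow> real"

definition tagged_partition :: "real \<Rightarrow> real \<Rightarrow> tagged_part \<Rightarrow> bool" where
  "tagged_partition u v P \<longleftrightarrow>
     num_parts P \<ge> 1 \<and> node P 0 = u \<and> node P (num_parts P) = v \<and>
     (\<forall>i\<in>{1..num_parts P}. node P (i - 1) < node P i \<and>
        tag P i \<in> rat_interval (node P (i - 1)) (node P i))"

definition partition_norm :: "tagged_part \<Rightarrow> real" where
  "partition_norm P = Max ((\<lambda>i. node P i - node P (i - 1)) ` {1..num_parts P})"

definition riemann_sum :: "(real \<Rightarrow> real) \<Rightarrow> tagged_part \<Rightarrow> real" where
  "riemann_sum f P = (\<Sum>i = 1..num_parts P. f (tag P i) * (node P i - node P (i - 1)))"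

definition has_rat_integral :: "(real \<Rightarrow> real) \<Rightarrow> real \<Rightarrow> real \<Rightarrow> real \<Rightarrow> bool" where
  "has_rat_integral f u v L \<longleftrightarrow>
     (\<forall>P. (\<forall>n. tagged_partition u v (P n)) \<and> (\<lambda>n. partition_norm (P n)) \<longlonglongrightarrow> 0
        \<longrightarrow> (\<lambda>n. riemann_sum f (P n)) \<longlonglongrightarrow> L)"

definition rat_integrable :: "(real \<Rightarrow> real) \<Rightarrow> real \<Rightarrow> real \<Rightarrow> bool" where
  "rat_integrable f u v \<longleftrightarrow> (\<exists>L. has_rat_integral f u v L)"

text \<open>It makes no difference whether the common limit is demanded up front or only the existence
  of a limit for each sequence of partitions.\<close>

lemma rat_integrable_iff_convergent:
  "rat_integrable f u v \<longleftrightarrow>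
     (\<forall>P. (\<forall>n. tagged_partition u v (P n)) \<and> (\<lambda>n. partition_norm (P n)) \<longlonglongrightarrow> 0
        \<longrightarrow> convergent (\<lambda>n. riemann_sum f (P n)))"
  (is "_ \<longleftrightarrow> (\<forall>P. ?adm P \<longrightarrow> ?conv P)")
proof
  assume "rat_integrable f u v"
  then show "\<forall>P. ?adm P \<longrightarrow> ?conv P"
    unfolding rat_integrable_def has_rat_integral_def convergent_def by blast
next
  assume R: "\<forall>P. ?adm P \<longrightarrow> ?conv P"
  show "rat_integrable f u v"
  proof (cases "\<exists>P. ?adm P")
    case False
    then show ?thesis unfolding rat_integrable_def has_rat_integral_def by blast
  next
    case True
    then obtain P0 where P0: "?adm P0" by blast
    then obtain L where L: "(\<lambda>n. riemann_sum f (P0 n)) \<longlonglongrightarrow> L"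
      using R unfolding convergent_def by blast
    have "(\<lambda>n. riemann_sum f (P n)) \<longlonglongrightarrow> L" if P: "?adm P" for P
    proof -
      define Q where "Q n = (if even n then P0 (n div 2) else P (n div 2))" for n :: nat
      have ev: "Q (2 * n) = P0 n" and od: "Q (2 * n + 1) = P n" for n
        by (auto simp: Q_def)
      have "(\<lambda>n. partition_norm (Q n)) \<longlonglongrightarrow> 0"
      proof (rule LIMSEQ_I)
        fix r :: real assume "r > 0"
        obtain N1 N2 where N: "\<And>n. n \<ge> N1 \<Longrightarrow> norm (partition_norm (P0 n) - 0) < r"
            "\<And>n. n \<ge> N2 \<Longrightarrow> norm (partition_norm (P n) - 0) < r"
          using LIMSEQ_D[OF conjunct2[OF P0] \<open>r > 0\<close>] LIMSEQ_D[OF conjunct2[OF P] \<open>r > 0\<close>] by blast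
        show "\<exists>no. \<forall>n\<ge>no. norm (partition_norm (Q n) - 0) < r"
        proof (intro exI allI impI)
          fix n assume "n \<ge> 2 * (N1 + N2)"
          then have "n div 2 \<ge> N1" "n div 2 \<ge> N2" by auto
          then show "norm (partition_norm (Q n) - 0) < r" using N by (simp add: Q_def)
        qed
      qed
      moreover have "\<forall>n. tagged_partition u v (Q n)" using P0 P by (simp add: Q_def)
      ultimately obtain M where M: "(\<lambda>n. riemann_sum f (Q n)) \<longlonglongrightarrow> M"
        using R unfolding convergent_def by blast
      have "strict_mono (\<lambda>n::nat. 2 * n)" "strict_mono (\<lambda>n::nat. 2 * n + 1)"
        by (auto intro: strict_monoI)
      from this[THEN LIMSEQ_subseq_LIMSEQ[OF M]]
      have "(\<lambda>n. riemann_sum f (P0 n)) \<longlonglongrightarrow> M" "(\<lambda>n. riemann_sum f (P n)) \<longlonglongrightarrow> M"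
        unfolding o_def ev od by auto
      then show ?thesis using L LIMSEQ_unique by blast
    qed
    then show ?thesis unfolding rat_integrable_def has_rat_integral_def by blast
  qed
qed

lemma tagged_partition_sequence_exists:
  assumes "u < v"
  obtains P where "\<And>n. tagged_partition u v (P n)" "(\<lambda>n. partition_norm (P n)) \<longlonglongrightarrow> 0"
proof -
  define x where "x n i = u + real i * ((v - u) / real (Suc n))" for n i
  define t where "t n i = (SOME r. r \<in> \<rat> \<and> x n (i - 1) < r \<and> r < x n i)" for n i
  define P where "P n = \<lparr>num_parts = Suc n, node = x n, tag = t n\<rparr>" for n
  have diff: "x n i - x n (i - 1) = (v - u) / real (Suc n)" if "i \<ge> 1" for n i
  proof -
    have "real i = real (i - 1) + 1" using that by simp
    then show ?thesis unfolding x_def by (simp only: distrib_right)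
  qed
  have less: "x n (i - 1) < x n i" if "i \<ge> 1" for n i
  proof -
    have "(v - u) / real (Suc n) > 0" using assms by simp
    then show ?thesis using diff[OF that, of n] by linarith
  qed
  have tag: "t n i \<in> rat_interval (x n (i - 1)) (x n i)" if "i \<ge> 1" for n i
    using someI_ex[OF Rats_dense_in_real[OF less[OF that, of n], unfolded Bex_def]]
    unfolding t_def rat_interval_def by auto
  have "tagged_partition u v (P n)" for n
    using less tag by (auto simp: tagged_partition_def P_def x_def simp del: of_nat_Suc)
  moreover have "partition_norm (P n) = (v - u) / real (Suc n)" for n
  proof -
    have "(\<lambda>i. x n i - x n (i - 1)) ` {1..Suc n} = {(v - u) / real (Suc n)}"
      using diff by (force simp del: of_nat_Suc)
    then show ?thesis unfolding partition_norm_def P_def by simp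
  qed
  moreover have "(\<lambda>n. (v - u) / real (Suc n)) \<longlonglongrightarrow> 0"
    by (rule LIMSEQ_Suc[OF lim_const_over_n])
  ultimately show ?thesis by (intro that[of P]) simp_all
qed

lemma has_rat_integral_unique:
  assumes "u < v" "has_rat_integral f u v L" "has_rat_integral f u v M"
  shows "L = M"
proof -
  obtain P where "\<And>n. tagged_partition u v (P n)" "(\<lambda>n. partition_norm (P n)) \<longlonglongrightarrow> 0"
    using tagged_partition_sequence_exists[OF assms(1)] by blast
  then have "(\<lambda>n. riemann_sum f (P n)) \<longlonglongrightarrow> L" "(\<lambda>n. riemann_sum f (P n)) \<longlonglongrightarrow> M"
    using assms(2,3) unfolding has_rat_integral_def by auto
  then show ?thesis by (rule LIMSEQ_unique)
qed

end

theory Submission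
  imports Defs
begin

text \<open>The rationals are dense in \<open>[u,v]\<close>, so \<open>f\<close> extends to a continuous function \<open>g\<close> on the real
  interval. On a part of a partition of norm less than \<open>\<delta>\<close>, where \<open>\<delta>\<close> is a modulus of uniform
  continuity of \<open>g\<close> for \<open>\<epsilon>\<close>, the summand differs from the Riemann integral of \<open>g\<close> by at most
  \<open>\<epsilon>\<close> times the length of the part. Hence the sums converge to the Riemann integral of \<open>g\<close>.\<close>

text \<open>The endpoints may be irrational, so density is used inside the open interval first:
  every point of an open set that lies in the closure of \<open>\<rat>\<close> is a limit of
  rationals from that open set. Closing up once more recovers \<open>u\<close> and
  \<open>v\<close>.\<close>

lemma closure_rat_interval:
  assumes "u < v"
  shows "closure (rat_interval u v) = {u..v}"
proof
  have "rat_interval u v \<subseteq> {u..v}"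
    by (auto simp: rat_interval_def)
  then show "closure (rat_interval u v) \<subseteq> {u..v}"
    by (simp add: closure_minimal)
  have "{u<..<v} \<inter> closure \<rat> \<subseteq> closure ({u<..<v} \<inter> \<rat>)"
    by (rule open_Int_closure_subset) simp
  also have "\<dots> \<subseteq> closure (rat_interval u v)"
    by (rule closure_mono) (auto simp: rat_interval_def)
  finally have "{u<..<v} \<subseteq> closure (rat_interval u v)"
    by (simp add: Rats_closure_real)
  then have "closure {u<..<v} \<subseteq> closure (rat_interval u v)"
    by (simp add: closure_minimal)
  then show "{u..v} \<subseteq> closure (rat_interval u v)"
    using assms by simp
qed

lemma tagged_partition_node_mono:
  assumes "tagged_partition u v P" "i \<le> j" "j \<le> num_parts P"
  shows "node P i \<le> node P j"
  using assms(2,3)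
proof (induction j rule: dec_induct)
  case (step m)
  then have "node P (Suc m - 1) < node P (Suc m)"
    using assms(1) unfolding tagged_partition_def by (metis atLeastAtMost_iff le_add1 plus_1_eq_Suc)
  with step show ?case by simp
qed simp

lemma tagged_partition_node_bounds:
  assumes "tagged_partition u v P" "i \<le> num_parts P"
  shows "u \<le> node P i" "node P i \<le> v"
  using tagged_partition_node_mono[OF assms(1), of 0 i]
    tagged_partition_node_mono[OF assms(1), of i "num_parts P"] assms
  by (auto simp: tagged_partition_def)

lemma node_diff_le_partition_norm:
  assumes "i \<in> {1..num_parts P}"
  shows "node P i - node P (i - 1) \<le> partition_norm P"
  using assms unfolding partition_norm_def by (intro Max_ge) auto

text \<open>As \<open>c * (b - a)\<close> is the integral of the constant \<open>c\<close>, the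
  difference is the integral of \<open>c - g\<close>. Later \<open>c\<close> is the value of
  \<open>g\<close> at a tag.\<close>

lemma abs_rectangle_minus_integral_le:
  fixes g :: "real \<Rightarrow> real"
  assumes "a \<le> b" "continuous_on {a..b} g" "\<And>x. x \<in> {a..b} \<Longrightarrow> \<bar>c - g x\<bar> \<le> e"
  shows "\<bar>c * (b - a) - integral {a..b} g\<bar> \<le> e * (b - a)"
proof -
  have "norm (integral {a..b} (\<lambda>x. c - g x)) \<le> e * (b - a)"
    using assms by (intro integral_bound continuous_intros) auto
  moreover have "integral {a..b} (\<lambda>x. c - g x) = c * (b - a) - integral {a..b} g"
    using assms by (subst integral_diff) (auto intro: integrable_continuous_real)
  ultimately show ?thesis by simp
qed

text \<open>The indefinite integral from \<open>u\<close> turns each term into a difference of its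
  values at consecutive nodes, so the sum telescopes.\<close>

lemma integral_eq_sum_over_parts:
  fixes g :: "real \<Rightarrow> real"
  assumes P: "tagged_partition u v P" and g: "g integrable_on {u..v}"
  shows "integral {u..v} g = (\<Sum>i = 1..num_parts P. integral {node P (i - 1)..node P i} g)"
proof -
  define G where "G x = integral {u..x} g" for x
  have "integral {node P (i - 1)..node P i} g = G (node P i) - G (node P (i - 1))"
    if "i \<in> {1..num_parts P}" for i
  proof -
    have "g integrable_on {u..node P i}"
      using g tagged_partition_node_bounds[OF P, of i] that
      by (auto intro: integrable_subinterval_real)
    then have "integral {u..node P (i - 1)} g + integral {node P (i - 1)..node P i} g
        = integral {u..node P i} g"
      using that tagged_partition_node_bounds[OF P, of "i - 1"]
        tagged_partition_node_mono[OF P, of "i - 1" i]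
      by (intro Henstock_Kurzweil_Integration.integral_combine) auto
    then show ?thesis by (simp add: G_def)
  qed
  then have "(\<Sum>i = 1..num_parts P. integral {node P (i - 1)..node P i} g)
      = (\<Sum>i = 1..num_parts P. G (node P i) - G (node P (i - 1)))"
    by (intro sum.cong) auto
  also have "\<dots> = G (node P (num_parts P)) - G (node P 0)"
    using sum_telescope''[of 0 "num_parts P" "\<lambda>i. G (node P i)"]
    by (simp add: sum.atLeast1_atMost_eq atLeast0AtMost)
  also have "\<dots> = integral {u..v} g"
    using P by (simp add: G_def tagged_partition_def)
  finally show ?thesis by simp
qed

text \<open>The errors on the parts are proportional to their lengths, which add up to
  \<open>v - u\<close>; hence the bound does not depend on the number of parts.\<close>

lemma abs_riemann_sum_minus_integral_le:
  fixes g :: "real \<Rightarrow> real"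
  assumes P: "tagged_partition u v P" and norm: "partition_norm P < d"
    and cont: "continuous_on {u..v} g"
    and modulus: "\<And>x y. x \<in> {u..v} \<Longrightarrow> y \<in> {u..v} \<Longrightarrow> \<bar>x - y\<bar> < d \<Longrightarrow> \<bar>g x - g y\<bar> \<le> e"
  shows "\<bar>riemann_sum g P - integral {u..v} g\<bar> \<le> e * (v - u)"
proof -
  have part: "\<bar>g (tag P i) * (node P i - node P (i - 1)) - integral {node P (i - 1)..node P i} g\<bar>
      \<le> e * (node P i - node P (i - 1))" if i: "i \<in> {1..num_parts P}" for i
  proof (rule abs_rectangle_minus_integral_le)
    have sub: "{node P (i - 1)..node P i} \<subseteq> {u..v}"
      using tagged_partition_node_bounds[OF P, of i] tagged_partition_node_bounds[OF P, of "i - 1"] i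
      by auto
    show "node P (i - 1) \<le> node P i"
      using tagged_partition_node_mono[OF P, of "i - 1" i] i by auto
    show "continuous_on {node P (i - 1)..node P i} g"
      using cont sub by (rule continuous_on_subset)
    have tag: "tag P i \<in> {node P (i - 1)..node P i}"
      using P i by (auto simp: tagged_partition_def rat_interval_def)
    show "\<bar>g (tag P i) - g x\<bar> \<le> e" if x: "x \<in> {node P (i - 1)..node P i}" for x
    proof (rule modulus)
      \<comment> \<open>Both points lie in the same part, whose length is at most the norm of
        \<open>P\<close>.\<close>
      show "\<bar>tag P i - x\<bar> < d"
        using tag x node_diff_le_partition_norm[OF i] norm by auto
    qed (use tag x sub in blast)+
  qed
  have "(\<Sum>i = 1..num_parts P. node P i - node P (i - 1)) = node P (num_parts P) - node P 0"
    using sum_telescope''[of 0 "num_parts P" "node P"]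
    by (simp add: sum.atLeast1_atMost_eq atLeast0AtMost)
  then have length: "(\<Sum>i = 1..num_parts P. node P i - node P (i - 1)) = v - u"
    using P by (simp add: tagged_partition_def)
  have "riemann_sum g P - integral {u..v} g = (\<Sum>i = 1..num_parts P.
      g (tag P i) * (node P i - node P (i - 1)) - integral {node P (i - 1)..node P i} g)"
    using integral_eq_sum_over_parts[OF P integrable_continuous_real[OF cont]]
    by (simp add: riemann_sum_def sum_subtractf)
  also have "\<bar>\<dots>\<bar> \<le> (\<Sum>i = 1..num_parts P. e * (node P i - node P (i - 1)))"
    using part by (intro order_trans[OF sum_abs] sum_mono)
  also have "\<dots> = e * (v - u)"
    by (simp only: length flip: sum_distrib_left)
  finally show ?thesis .
qed

text \<open>Compactness of \<open>{u..v}\<close> yields one \<open>d\<close> valid for all pairs of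
  points, so the norm alone controls the error, whatever the sequence of partitions.\<close>

lemma has_rat_integral_continuous:
  fixes g :: "real \<Rightarrow> real"
  assumes "u < v" and cont: "continuous_on {u..v} g"
  shows "has_rat_integral g u v (integral {u..v} g)"
  unfolding has_rat_integral_def
proof (intro allI impI LIMSEQ_I, elim conjE)
  fix P and r :: real
  assume P: "\<forall>n. tagged_partition u v (P n)" and lim: "(\<lambda>n. partition_norm (P n)) \<longlonglongrightarrow> 0"
    and r: "0 < r"
  \<comment> \<open>The factor 2 makes \<open>e * (v - u)\<close> equal to \<open>r / 2\<close>,
    since the estimate for the sums is non-strict and a strict one is required.\<close>
  define e where "e = r / (2 * (v - u))"
  have e: "0 < e" "e * (v - u) < r"
    using r assms(1) by (auto simp: e_def field_simps)
  have "uniformly_continuous_on {u..v} g"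
    using cont by (intro compact_uniformly_continuous) auto
  then obtain d where d: "0 < d"
    "\<And>x y. x \<in> {u..v} \<Longrightarrow> y \<in> {u..v} \<Longrightarrow> \<bar>x - y\<bar> < d \<Longrightarrow> \<bar>g x - g y\<bar> < e"
    using e(1) unfolding uniformly_continuous_on_def dist_real_def by metis
  obtain N where N: "partition_norm (P n) < d" if "n \<ge> N" for n
    using LIMSEQ_D[OF lim d(1)] by (auto simp: abs_less_iff)
  have "norm (riemann_sum g (P n) - integral {u..v} g) < r" if "n \<ge> N" for n
  proof -
    have "\<bar>riemann_sum g (P n) - integral {u..v} g\<bar> \<le> e * (v - u)"
      using P N[OF that] cont d(2)
      by (intro abs_riemann_sum_minus_integral_le) (auto intro: less_imp_le)
    with e(2) show ?thesis by simp
  qed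
  then show "\<exists>N. \<forall>n\<ge>N. norm (riemann_sum g (P n) - integral {u..v} g) < r"
    by blast
qed

text \<open>All tags are rational points between \<open>u\<close> and \<open>v\<close>, so a Riemann
  sum cannot distinguish a function on the rationals from its extension to the reals.\<close>

lemma riemann_sum_cong:
  assumes P: "tagged_partition u v P" and eq: "\<And>x. x \<in> rat_interval u v \<Longrightarrow> f x = g x"
  shows "riemann_sum f P = riemann_sum g P"
  unfolding riemann_sum_def
proof (rule sum.cong)
  fix i assume i: "i \<in> {1..num_parts P}"
  then have "tag P i \<in> rat_interval (node P (i - 1)) (node P i)"
    using P by (simp add: tagged_partition_def)
  moreover have "u \<le> node P (i - 1)" "node P i \<le> v"
    using i by (auto intro!: tagged_partition_node_bounds[OF P])
  ultimately have "tag P i \<in> rat_interval u v"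
    by (auto simp: rat_interval_def)
  then show "f (tag P i) * (node P i - node P (i - 1)) = g (tag P i) * (node P i - node P (i - 1))"
    by (simp add: eq)
qed simp

theorem theorem2p61:
  fixes u v :: real and f :: "real \<Rightarrow> real"
  assumes "u < v"
    and "uniformly_continuous_on (rat_interval u v) f"
  shows "rat_integrable f u v"
proof -
  \<comment> \<open>Uniform continuity maps Cauchy sequences to Cauchy sequences, so by completeness
    \<open>f\<close> has a limit at every point of the closure.\<close>
  obtain g where "uniformly_continuous_on (closure (rat_interval u v)) g"
    and eq: "\<And>x. x \<in> rat_interval u v \<Longrightarrow> f x = g x"
    using uniformly_continuous_on_extension_on_closure[OF assms(2)] by metis
  then have "continuous_on {u..v} g"
    using closure_rat_interval[OF assms(1)] uniformly_continuous_imp_continuous by metis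
  then have "has_rat_integral g u v (integral {u..v} g)"
    by (rule has_rat_integral_continuous[OF assms(1)])
  moreover have "riemann_sum f P = riemann_sum g P" if "tagged_partition u v P" for P
    using that eq by (rule riemann_sum_cong)
  ultimately show ?thesis
    unfolding rat_integrable_def has_rat_integral_def by auto
qed

end
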